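(* There exist a sequence of finite abelian groups $G_n$ and subsets $E_n\subseteq G_n$ such that $1<\rho(E_n)$ for every $n$ and $\rho(E_n)\to 1$ as $n\to\infty$.
   Context: Let $G$ be a finite abelian group with dual group $\widehat G$ (characters $G\to\mathbb{S}^1$). For nonempty $E=\{x_1,\dots,x_n\}\subseteq G$ and $B=\{b_1,\dots,b_n\}\subseteq\widehat G$ of the same size, let $T(E,B)$ be the $n\times n$ matrix with $(i,j)$ entry $b_j(x_i)$, and let $\rho_E(B)=\operatorname{cond}(T(E,B))^2=\|T\|^2\|T^{-1}\|^2$ (operator $2$-norm), defined to be $\infty$ if $T(E,B)$ is singular. The Riesz ratio of $E$ is $\rho(E)=\min\{\rho_E(B): B\subseteq\widehat G,\ |B|=|E|\}$. *)

theory Defs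
  imports
    "HOL-Algebra.Multiplicative_Group"
    "HOL-Analysis.L2_Norm"
    "HOL-Library.Countable_Set"
    "HOL-Library.Extended_Real"
    "Jordan_Normal_Form.Gauss_Jordan_Elimination"
begin

definition circle_group :: "complex monoid" where
  "circle_group = \<lparr>carrier = {z. cmod z = 1}, monoid.mult = (*), one = 1\<rparr>"

text \<open>Characters are extensional (\<open>undefined\<close> off the carrier), so that distinct elements of
  the following set are distinct characters.\<close>

definition characters :: "('a, 'b) monoid_scheme \<Rightarrow> ('a \<Rightarrow> complex) set" where
  "characters G = hom G circle_group \<inter> extensional (carrier G)"

definition vec_norm2 :: "complex vec \<Rightarrow> real" where
  "vec_norm2 v = L2_set (\<lambda>i. cmod (v $ i)) {..<dim_vec v}"

definition op_norm2 :: "complex mat \<Rightarrow> real" where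
  "op_norm2 A =
    (SUP v \<in> {v \<in> carrier_vec (dim_col A). vec_norm2 v = 1}. vec_norm2 (A *\<^sub>v v))"

definition mat_cond :: "complex mat \<Rightarrow> ereal" where
  "mat_cond A =
    (case mat_inverse A of None \<Rightarrow> \<infinity> | Some A' \<Rightarrow> ereal (op_norm2 A * op_norm2 A'))"

text \<open>The rows and columns are ordered by the enumeration \<open>from_nat_into\<close> of a finite set, a
  bijection from \<open>{..<card S}\<close> to \<open>S\<close>; the condition number does not depend on this choice, see
  \<open>mat_cond_char_mat\<close> below.\<close>

definition char_mat :: "'a set \<Rightarrow> ('a \<Rightarrow> complex) set \<Rightarrow> complex mat" where
  "char_mat E B = mat (card E) (card B) (\<lambda>(i, j). from_nat_into B j (from_nat_into E i))"

definition riesz_ratio_wrt :: "'a set \<Rightarrow> ('a \<Rightarrow> complex) set \<Rightarrow> ereal" where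
  "riesz_ratio_wrt E B = (mat_cond (char_mat E B))\<^sup>2"

definition riesz_ratio :: "('a, 'b) monoid_scheme \<Rightarrow> 'a set \<Rightarrow> ereal" where
  "riesz_ratio G E = Min {riesz_ratio_wrt E B | B. B \<subseteq> characters G \<and> card B = card E}"


subsection \<open>Well-definedness\<close>

lemma op_norm2_image_reindex:
  fixes A :: "complex mat"
  assumes A: "A \<in> carrier_mat n n"
    and s: "bij_betw s {..<n} {..<n}" and t: "bij_betw t {..<n} {..<n}"
  defines "A' \<equiv> mat n n (\<lambda>(i, j). A $$ (s i, t j))"
  shows "(\<lambda>v. vec_norm2 (A *\<^sub>v v)) ` {v \<in> carrier_vec n. vec_norm2 v = 1}
    \<subseteq> (\<lambda>v. vec_norm2 (A' *\<^sub>v v)) ` {v \<in> carrier_vec n. vec_norm2 v = 1}"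
proof clarify
  fix v :: "complex vec"
  assume v: "v \<in> carrier_vec n" "vec_norm2 v = 1"
  define w where "w = vec n (\<lambda>j. v $ t j)"
  have sl: "s i < n" and tl: "t i < n" if "i < n" for i
    using s t that by (auto simp: bij_betw_def)
  have w: "vec_norm2 w = vec_norm2 v"
    using v(1) sum.reindex_bij_betw[OF t, of "\<lambda>i. (cmod (v $ i))\<^sup>2"]
    by (simp add: vec_norm2_def L2_set_def w_def)
  have entry: "(A' *\<^sub>v w) $ i = (A *\<^sub>v v) $ s i" if "i < n" for i
  proof -
    have "(A' *\<^sub>v w) $ i = (\<Sum>j\<in>{..<n}. A $$ (s i, t j) * v $ t j)"
      using that by (auto simp: A'_def w_def scalar_prod_def atLeast0LessThan)
    also have "\<dots> = (\<Sum>j\<in>{..<n}. A $$ (s i, j) * v $ j)"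
      by (rule sum.reindex_bij_betw[OF t])
    also have "\<dots> = (A *\<^sub>v v) $ s i"
      using sl[OF that] A v(1) by (auto simp: scalar_prod_def atLeast0LessThan)
    finally show ?thesis .
  qed
  have "vec_norm2 (A' *\<^sub>v w) = L2_set (\<lambda>i. cmod ((A *\<^sub>v v) $ s i)) {..<n}"
    unfolding vec_norm2_def
    by (rule L2_set_cong) (auto simp: A'_def entry[unfolded A'_def] simp del: index_mult_mat_vec)
  also have "\<dots> = vec_norm2 (A *\<^sub>v v)"
    using A sum.reindex_bij_betw[OF s, of "\<lambda>i. (cmod ((A *\<^sub>v v) $ i))\<^sup>2"]
    by (simp add: vec_norm2_def L2_set_def)
  finally have "vec_norm2 (A *\<^sub>v v) = vec_norm2 (A' *\<^sub>v w)" ..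
  moreover have "w \<in> {v \<in> carrier_vec n. vec_norm2 v = 1}"
    using w v by (simp add: w_def)
  ultimately show "vec_norm2 (A *\<^sub>v v)
      \<in> (\<lambda>v. vec_norm2 (A' *\<^sub>v v)) ` {v \<in> carrier_vec n. vec_norm2 v = 1}"
    by blast
qed

lemma mat_reindex_inverse:
  assumes A: "A \<in> carrier_mat n n"
    and s: "bij_betw s {..<n} {..<n}" and t: "bij_betw t {..<n} {..<n}"
  shows "mat n n (\<lambda>(i, j). mat n n (\<lambda>(i, j). A $$ (s i, t j)) $$
    (inv_into {..<n} s i, inv_into {..<n} t j)) = A"
proof (rule eq_matI)
  fix i j assume "i < dim_row A" "j < dim_col A"
  then have ij: "i < n" "j < n" using A by auto
  have "inv_into {..<n} s i < n" "inv_into {..<n} t j < n"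
    using ij bij_betw_inv_into[OF s] bij_betw_inv_into[OF t] by (auto simp: bij_betw_def)
  then show "mat n n (\<lambda>(i, j). mat n n (\<lambda>(i, j). A $$ (s i, t j)) $$
      (inv_into {..<n} s i, inv_into {..<n} t j)) $$ (i, j) = A $$ (i, j)"
    using ij bij_betw_inv_into_right[OF s, of i] bij_betw_inv_into_right[OF t, of j] by simp
qed (use A in auto)

lemma op_norm2_reindex:
  fixes A :: "complex mat"
  assumes A: "A \<in> carrier_mat n n"
    and s: "bij_betw s {..<n} {..<n}" and t: "bij_betw t {..<n} {..<n}"
  shows "op_norm2 (mat n n (\<lambda>(i, j). A $$ (s i, t j))) = op_norm2 A"
proof -
  let ?A = "mat n n (\<lambda>(i, j). A $$ (s i, t j))"
  have c: "?A \<in> carrier_mat n n" by simp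
  have "(\<lambda>v. vec_norm2 (?A *\<^sub>v v)) ` {v \<in> carrier_vec n. vec_norm2 v = 1}
      = (\<lambda>v. vec_norm2 (A *\<^sub>v v)) ` {v \<in> carrier_vec n. vec_norm2 v = 1}"
    using op_norm2_image_reindex[OF A s t]
      op_norm2_image_reindex[OF c bij_betw_inv_into[OF s] bij_betw_inv_into[OF t]]
    unfolding mat_reindex_inverse[OF A s t] by (rule antisym[rotated])
  then show ?thesis using A by (simp add: op_norm2_def)
qed

lemma mat_mult_reindex:
  fixes A C :: "complex mat"
  assumes A: "A \<in> carrier_mat n n" and C: "C \<in> carrier_mat n n" and AC: "A * C = 1\<^sub>m n"
    and s: "bij_betw s {..<n} {..<n}" and t: "bij_betw t {..<n} {..<n}"
  shows "mat n n (\<lambda>(i, j). A $$ (s i, t j)) * mat n n (\<lambda>(i, j). C $$ (t i, s j)) = 1\<^sub>m n"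
proof (rule eq_matI)
  fix i j assume "i < dim_row (1\<^sub>m n :: complex mat)" "j < dim_col (1\<^sub>m n :: complex mat)"
  then have ij: "i < n" "j < n" by auto
  have sl: "s i < n" "s j < n" using ij s by (auto simp: bij_betw_def)
  have "(mat n n (\<lambda>(i, j). A $$ (s i, t j)) * mat n n (\<lambda>(i, j). C $$ (t i, s j))) $$ (i, j)
      = (\<Sum>k\<in>{..<n}. A $$ (s i, t k) * C $$ (t k, s j))"
    using ij by (auto simp: scalar_prod_def atLeast0LessThan)
  also have "\<dots> = (\<Sum>k\<in>{..<n}. A $$ (s i, k) * C $$ (k, s j))"
    by (rule sum.reindex_bij_betw[OF t])
  also have "\<dots> = (A * C) $$ (s i, s j)"
    using sl A C by (auto simp: scalar_prod_def atLeast0LessThan)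
  also have "\<dots> = 1\<^sub>m n $$ (i, j)"
    using sl ij s by (auto simp: AC bij_betw_def inj_on_def)
  finally show "(mat n n (\<lambda>(i, j). A $$ (s i, t j)) * mat n n (\<lambda>(i, j). C $$ (t i, s j)))
      $$ (i, j) = 1\<^sub>m n $$ (i, j)" .
qed auto

lemma mat_inverse_eqI:
  fixes A C :: "'a :: field mat"
  assumes A: "A \<in> carrier_mat n n" and C: "C \<in> carrier_mat n n"
    and AC: "A * C = 1\<^sub>m n" and CA: "C * A = 1\<^sub>m n"
  shows "mat_inverse A = Some C"
proof (cases "mat_inverse A")
  case None
  have "A \<in> Units (ring_mat TYPE('a) n ())"
    using A C AC CA by (auto simp: Units_def ring_mat_def)
  with mat_inverse(1)[OF A None, of "()"] show ?thesis by blast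
next
  case (Some D)
  from mat_inverse(2)[OF A Some] have D: "D * A = 1\<^sub>m n" "D \<in> carrier_mat n n" by auto
  have "D = D * (A * C)" using D AC by simp
  also have "\<dots> = D * A * C" by (rule assoc_mult_mat[OF D(2) A C, symmetric])
  also have "\<dots> = C" using D C by simp
  finally show ?thesis using Some by simp
qed

lemma mat_cond_reindex_finite:
  fixes A :: "complex mat"
  assumes A: "A \<in> carrier_mat n n" and C: "mat_inverse A = Some C"
    and s: "bij_betw s {..<n} {..<n}" and t: "bij_betw t {..<n} {..<n}"
  shows "mat_inverse (mat n n (\<lambda>(i, j). A $$ (s i, t j)))
    = Some (mat n n (\<lambda>(i, j). C $$ (t i, s j)))"
proof -
  from mat_inverse(2)[OF A C]
  have *: "A * C = 1\<^sub>m n" "C * A = 1\<^sub>m n" "C \<in> carrier_mat n n" by auto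
  show ?thesis
    by (rule mat_inverse_eqI[OF _ _ mat_mult_reindex[OF A *(3) *(1) s t]
          mat_mult_reindex[OF *(3) A *(2) t s]]) auto
qed

lemma mat_cond_reindex:
  fixes A :: "complex mat"
  assumes A: "A \<in> carrier_mat n n"
    and s: "bij_betw s {..<n} {..<n}" and t: "bij_betw t {..<n} {..<n}"
  shows "mat_cond (mat n n (\<lambda>(i, j). A $$ (s i, t j))) = mat_cond A"
proof (cases "mat_inverse A")
  case None
  have "mat_inverse (mat n n (\<lambda>(i, j). A $$ (s i, t j))) = None"
  proof (rule ccontr)
    assume "mat_inverse (mat n n (\<lambda>(i, j). A $$ (s i, t j))) \<noteq> None"
    then obtain C where C: "mat_inverse (mat n n (\<lambda>(i, j). A $$ (s i, t j))) = Some C" by blast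
    from mat_cond_reindex_finite[OF _ C bij_betw_inv_into[OF s] bij_betw_inv_into[OF t]] None
    show False unfolding mat_reindex_inverse[OF A s t] by simp
  qed
  with None show ?thesis by (simp add: mat_cond_def)
next
  case (Some C)
  have C: "C \<in> carrier_mat n n" using mat_inverse(2)[OF A Some] by blast
  show ?thesis
    using mat_cond_reindex_finite[OF A Some s t] Some op_norm2_reindex[OF A s t]
      op_norm2_reindex[OF C t s]
    by (simp add: mat_cond_def)
qed

lemma mat_cond_char_mat:
  assumes f: "bij_betw f {..<n} E" and g: "bij_betw g {..<n} B"
  shows "mat_cond (char_mat E B) = mat_cond (mat n n (\<lambda>(i, j). g j (f i)))"
proof -
  have fin: "finite E" "finite B" using f g bij_betw_finite by blast+
  have card: "card E = n" "card B = n" using bij_betw_same_card[OF f] bij_betw_same_card[OF g] by auto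
  have ef: "bij_betw (from_nat_into E) {..<n} E" "bij_betw (from_nat_into B) {..<n} B"
    using bij_betw_from_nat_into_finite fin card by metis+
  let ?s = "inv_into {..<n} f \<circ> from_nat_into E"
  let ?t = "inv_into {..<n} g \<circ> from_nat_into B"
  let ?A = "mat n n (\<lambda>(i, j). g j (f i))"
  have s: "bij_betw ?s {..<n} {..<n}" and t: "bij_betw ?t {..<n} {..<n}"
    using bij_betw_trans[OF ef(1) bij_betw_inv_into[OF f]]
      bij_betw_trans[OF ef(2) bij_betw_inv_into[OF g]] by auto
  have "char_mat E B = mat n n (\<lambda>(i, j). ?A $$ (?s i, ?t j))"
  proof (rule eq_matI)
    fix i j assume "i < dim_row (mat n n (\<lambda>(i, j). ?A $$ (?s i, ?t j)))"
      "j < dim_col (mat n n (\<lambda>(i, j). ?A $$ (?s i, ?t j)))"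
    then have ij: "i < n" "j < n" by auto
    have st: "?s i < n" "?t j < n" using s t ij by (auto simp: bij_betw_def)
    have "from_nat_into E i \<in> E" "from_nat_into B j \<in> B"
      using ef ij by (auto simp: bij_betw_def)
    then have "f (?s i) = from_nat_into E i" "g (?t j) = from_nat_into B j"
      using bij_betw_inv_into_right[OF f] bij_betw_inv_into_right[OF g] by auto
    then show "char_mat E B $$ (i, j) = mat n n (\<lambda>(i, j). ?A $$ (?s i, ?t j)) $$ (i, j)"
      using ij st card by (simp add: char_mat_def)
  qed (auto simp: char_mat_def card)
  then show ?thesis using mat_cond_reindex[OF _ s t, of ?A] by simp
qed

text \<open>The minimum in the definition of \<open>riesz_ratio\<close> is over a finite set.\<close>

lemma finite_characters:
  assumes "group G" and fin: "finite (carrier G)"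
  shows "finite (characters G)"
proof (rule finite_subset)
  interpret group G by fact
  let ?n = "Coset.order G"
  have pos: "?n > 0" using fin order_gt_0_iff_finite by blast
  show "characters G \<subseteq> PiE (carrier G) (\<lambda>_. {z. z ^ ?n = 1})"
  proof (clarsimp simp: characters_def PiE_iff)
    fix h x assume h: "h \<in> hom G circle_group" and x: "x \<in> carrier G"
    have mult: "h (a \<otimes>\<^bsub>G\<^esub> b) = h a * h b" if "a \<in> carrier G" "b \<in> carrier G" for a b
      using hom_mult[OF h that] by (simp add: circle_group_def)
    have "cmod (h \<one>\<^bsub>G\<^esub>) = 1" using hom_in_carrier[OF h] by (simp add: circle_group_def)
    then have "h \<one>\<^bsub>G\<^esub> \<noteq> 0" by auto
    then have one: "h \<one>\<^bsub>G\<^esub> = 1" using mult[of "\<one>\<^bsub>G\<^esub>" "\<one>\<^bsub>G\<^esub>"] by simp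
    have "h (x [^]\<^bsub>G\<^esub> k) = h x ^ k" for k :: nat
      by (induction k) (simp_all add: one mult x)
    from this[of ?n] show "h x ^ ?n = 1" using pow_order_eq_1[OF x] one by simp
  qed
  show "finite (PiE (carrier G) (\<lambda>_. {z :: complex. z ^ ?n = 1}))"
    using fin pos by (intro finite_PiE finite_roots_unity) auto
qed

end

theory Submission
  imports Defs "HOL-Algebra.Elementary_Groups" "Jordan_Normal_Form.Determinant"
begin

text \<open>
  Take \<open>E = {0, 1}\<close> in the cyclic group of odd order \<open>N\<close>. Two characters with values \<open>p\<close> and \<open>q\<close>
  at 1 give the matrix with rows \<open>(1, 1)\<close> and \<open>(p, q)\<close>, whose Gram matrix has the eigenvalues
  \<open>2 \<plusminus> |s|\<close> with \<open>s = 1 + p * cnj q\<close>, so its squared condition number is \<open>(2 + |s|) / (2 - |s|)\<close>.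
  Since \<open>p * cnj q\<close> is an \<open>N\<close>-th root of unity and \<open>N\<close> is odd, it never equals \<open>-1\<close>, so this is
  always greater than 1; but for large \<open>N\<close> it can be taken arbitrarily close to \<open>-1\<close>.
\<close>

section \<open>Condition numbers from extremal stretch factors\<close>

lemma vec_norm2_nonneg: "0 \<le> vec_norm2 v"
  by (simp add: vec_norm2_def)

lemma vec_norm2_eq_0_imp_eq_zero:
  assumes "v \<in> carrier_vec n" "vec_norm2 v = 0"
  shows "v = 0\<^sub>v n"
  using assms by (intro eq_vecI) (auto simp: vec_norm2_def L2_set_eq_0_iff)

lemma vec_norm2_smult: "vec_norm2 (c \<cdot>\<^sub>v v) = cmod c * vec_norm2 v"
proof -
  have "vec_norm2 (c \<cdot>\<^sub>v v) = L2_set (\<lambda>i. cmod c * cmod (v $ i)) {..<dim_vec v}"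
    unfolding vec_norm2_def by (rule L2_set_cong) (auto simp: norm_mult)
  also have "\<dots> = cmod c * vec_norm2 v"
    by (simp add: vec_norm2_def L2_set_right_distrib)
  finally show ?thesis .
qed

text \<open>The numbers \<open>a\<close> and \<open>b\<close> are the least and greatest factors by
  which \<open>A\<close> stretches a vector, attained at \<open>v\<close> and \<open>w\<close>. So
  \<open>A\<close> has norm \<open>b\<close>, and its inverse, which undoes the stretching, has norm
  \<open>1 / a\<close>.\<close>

lemma mat_cond_eqI:
  fixes A :: "complex mat"
  assumes A: "A \<in> carrier_mat n n" and a: "0 < a"
    and lower: "\<And>v. v \<in> carrier_vec n \<Longrightarrow> a * vec_norm2 v \<le> vec_norm2 (A *\<^sub>v v)"
    and upper: "\<And>v. v \<in> carrier_vec n \<Longrightarrow> vec_norm2 (A *\<^sub>v v) \<le> b * vec_norm2 v"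
    and v: "v \<in> carrier_vec n" "vec_norm2 v = 1" "vec_norm2 (A *\<^sub>v v) = a"
    and w: "w \<in> carrier_vec n" "vec_norm2 w = 1" "vec_norm2 (A *\<^sub>v w) = b"
  shows "mat_cond A = ereal (b / a)"
proof -
  \<comment> \<open>Since \<open>a > 0\<close>, the lower bound makes the kernel of \<open>A\<close>
    trivial.\<close>
  have "det A \<noteq> 0"
  proof
    assume "det A = 0"
    then obtain u where u: "u \<in> carrier_vec n" "u \<noteq> 0\<^sub>v n" "A *\<^sub>v u = 0\<^sub>v n"
      using det_0_iff_vec_prod_zero[OF A] by blast
    have "vec_norm2 (0\<^sub>v n) = 0" by (simp add: vec_norm2_def L2_set_def)
    then have "a * vec_norm2 u \<le> 0" using lower[OF u(1)] u(3) by simp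
    then have "vec_norm2 u = 0" using a vec_norm2_nonneg[of u] by (simp add: mult_le_0_iff)
    with u show False using vec_norm2_eq_0_imp_eq_zero by blast
  qed
  then obtain C where C: "mat_inverse A = Some C"
    using mat_inverse(1)[OF A, of "()"] det_non_zero_imp_unit[OF A, of "()"] by blast
  then have AC: "A * C = 1\<^sub>m n" "C * A = 1\<^sub>m n" "C \<in> carrier_mat n n"
    using mat_inverse(2)[OF A C] by auto
  have "op_norm2 A = b"
    unfolding op_norm2_def
  proof (rule cSup_eq_maximum)
    show "b \<in> (\<lambda>v. vec_norm2 (A *\<^sub>v v)) ` {v \<in> carrier_vec (dim_col A). vec_norm2 v = 1}"
      using w A by (intro image_eqI[of _ _ w]) auto
  qed (use A upper in fastforce)
  moreover have "op_norm2 C = 1 / a"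
    unfolding op_norm2_def
  proof (rule cSup_eq_maximum)
    \<comment> \<open>The image of the least stretched vector, normalised: the inverse stretches it
      by exactly \<open>1 / a\<close>.\<close>
    define u where "u = complex_of_real (1 / a) \<cdot>\<^sub>v (A *\<^sub>v v)"
    have u: "u \<in> carrier_vec n" using A v by (auto simp: u_def)
    have "vec_norm2 u = 1" using a v(3) by (simp add: u_def vec_norm2_smult norm_divide)
    moreover have "C *\<^sub>v u = complex_of_real (1 / a) \<cdot>\<^sub>v v"
    proof -
      have "C *\<^sub>v u = complex_of_real (1 / a) \<cdot>\<^sub>v (C *\<^sub>v (A *\<^sub>v v))"
        unfolding u_def using A AC(3) v(1) by (intro mult_mat_vec) auto
      also have "C *\<^sub>v (A *\<^sub>v v) = v"
        using assoc_mult_mat_vec[OF AC(3) A v(1)] AC(2) v(1) by simp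
      finally show ?thesis .
    qed
    then have "vec_norm2 (C *\<^sub>v u) = 1 / a"
      using a v(2) by (simp add: vec_norm2_smult norm_divide)
    ultimately show "1 / a \<in> (\<lambda>v. vec_norm2 (C *\<^sub>v v)) ` {v \<in> carrier_vec (dim_col C). vec_norm2 v = 1}"
      using u AC(3) by (intro image_eqI[of _ _ u]) auto
  next
    fix y assume "y \<in> (\<lambda>v. vec_norm2 (C *\<^sub>v v)) ` {v \<in> carrier_vec (dim_col C). vec_norm2 v = 1}"
    then obtain u where u: "u \<in> carrier_vec n" "vec_norm2 u = 1" "y = vec_norm2 (C *\<^sub>v u)"
      using AC(3) by auto
    \<comment> \<open>The lower bound for \<open>A\<close> at \<open>C *\<^sub>v u\<close> is the
      upper bound for \<open>C\<close> at \<open>u\<close>.\<close>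
    have "A *\<^sub>v (C *\<^sub>v u) = u"
      using assoc_mult_mat_vec[OF A AC(3) u(1)] AC(1) u(1) by simp
    then have "a * y \<le> 1"
      using lower[of "C *\<^sub>v u"] u AC(3) by auto
    then show "y \<le> 1 / a" using a by (simp add: field_simps)
  qed
  ultimately show ?thesis by (simp add: mat_cond_def C)
qed

lemma mat_cond_singular:
  assumes A: "A \<in> carrier_mat n n" and "v \<in> carrier_vec n" "v \<noteq> 0\<^sub>v n" "A *\<^sub>v v = 0\<^sub>v n"
  shows "mat_cond A = \<infinity>"
proof (cases "mat_inverse A")
  case None
  then show ?thesis by (simp add: mat_cond_def)
next
  case (Some C)
  then have C: "C * A = 1\<^sub>m n" "C \<in> carrier_mat n n"
    using mat_inverse(2)[OF A Some] by auto
  have "v = C *\<^sub>v (A *\<^sub>v v)"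
    using assoc_mult_mat_vec[OF C(2) A assms(2)] C(1) assms(2) by simp
  also have "\<dots> = 0\<^sub>v n" using C(2) assms(4) by auto
  finally show ?thesis using assms(3) by simp
qed

section \<open>The matrix of two characters on two points\<close>

lemma vec_norm2_dim2:
  assumes "v \<in> carrier_vec 2"
  shows "vec_norm2 v = sqrt ((cmod (v $ 0))\<^sup>2 + (cmod (v $ 1))\<^sup>2)"
  using assms by (simp add: vec_norm2_def L2_set_def numeral_2_eq_2)

text \<open>Expanding both squares, the two cross terms share the factor \<open>x * cnj y\<close>.
  This is the quadratic form of the Gram matrix, with off-diagonal coefficient
  \<open>1 + p * cnj q\<close>.\<close>

lemma norm_char_rows:
  fixes p q x y :: complex
  assumes "cmod p = 1" "cmod q = 1"
  shows "(cmod (x + y))\<^sup>2 + (cmod (p * x + q * y))\<^sup>2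
    = 2 * ((cmod x)\<^sup>2 + (cmod y)\<^sup>2) + 2 * Re (x * cnj y * (1 + p * cnj q))"
proof -
  have add: "(cmod (z + w))\<^sup>2 = (cmod z)\<^sup>2 + (cmod w)\<^sup>2 + 2 * Re (z * cnj w)" for z w
    unfolding cmod_power2 by (simp add: power2_eq_square algebra_simps)
  have "(p * x) * cnj (q * y) = x * cnj y * (p * cnj q)" by simp
  then show ?thesis
    unfolding add using assms by (simp add: norm_mult algebra_simps)
qed

text \<open>The cross term is at most \<open>cmod s\<close> times the squared norm, because 2|x||y|
  is at most |x|^2 + |y|^2. Explicit vectors attain both resulting bounds, so
  \<open>mat_cond_eqI\<close> applies without diagonalising the Gram matrix.\<close>

lemma mat_cond_char_2:
  fixes p q :: complex
  assumes p: "cmod p = 1" and q: "cmod q = 1"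
  defines "A \<equiv> mat 2 2 (\<lambda>(i, j). if i = 0 then 1 else if j = 0 then p else q)"
    and "s \<equiv> 1 + p * cnj q"
  shows "p = q \<Longrightarrow> mat_cond A = \<infinity>"
    and "p \<noteq> q \<Longrightarrow> cmod s < 2"
    and "p \<noteq> q \<Longrightarrow> (mat_cond A)\<^sup>2 = ereal ((2 + cmod s) / (2 - cmod s))"
proof -
  have A: "A \<in> carrier_mat 2 2" by (simp add: A_def)
  have mult: "A *\<^sub>v v = vec 2 (\<lambda>i. if i = 0 then v $ 0 + v $ 1 else p * v $ 0 + q * v $ 1)"
    if "v \<in> carrier_vec 2" for v
    using that by (intro eq_vecI) (auto simp: A_def scalar_prod_def numeral_2_eq_2)
  {
    assume "p = q"
    \<comment> \<open>The two columns coincide, so their difference vanishes.\<close>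
    let ?v = "vec 2 (\<lambda>i. if i = 0 then 1 else - 1) :: complex vec"
    have "?v $ 0 \<noteq> 0\<^sub>v 2 $ 0" by simp
    then have "?v \<noteq> 0\<^sub>v 2" by metis
    moreover have "A *\<^sub>v ?v = 0\<^sub>v 2"
      by (subst mult) (auto simp: \<open>p = q\<close>)
    ultimately show "mat_cond A = \<infinity>"
      using mat_cond_singular[OF A, of ?v] by simp
  }
  have norm_A: "vec_norm2 (A *\<^sub>v v) = sqrt (2 * (vec_norm2 v)\<^sup>2 + 2 * Re (v $ 0 * cnj (v $ 1) * s))"
    if "v \<in> carrier_vec 2" for v
    using norm_char_rows[OF p q, of "v $ 0" "v $ 1"] that mult[OF that]
    by (simp add: vec_norm2_dim2 s_def)
  have re: "\<bar>2 * Re (v $ 0 * cnj (v $ 1) * s)\<bar> \<le> cmod s * (vec_norm2 v)\<^sup>2"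
    if "v \<in> carrier_vec 2" for v
  proof -
    have "\<bar>2 * Re (v $ 0 * cnj (v $ 1) * s)\<bar> \<le> 2 * cmod (v $ 0 * cnj (v $ 1) * s)"
      using abs_Re_le_cmod[of "v $ 0 * cnj (v $ 1) * s"] by simp
    also have "\<dots> = cmod s * (2 * cmod (v $ 0) * cmod (v $ 1))"
      by (simp add: norm_mult)
    also have "\<dots> \<le> cmod s * (vec_norm2 v)\<^sup>2"
      using sum_squares_bound[of "cmod (v $ 0)" "cmod (v $ 1)"] that
      by (intro mult_left_mono) (auto simp: vec_norm2_dim2)
    finally show ?thesis .
  qed
  show lt: "cmod s < 2" if "p \<noteq> q"
  proof -
    \<comment> \<open>Multiplying by the unit \<open>cnj q\<close> shows
      \<open>cmod s = cmod (p + q)\<close>; the rest is the parallelogram law.\<close>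
    have "(cmod s)\<^sup>2 + (cmod (p - q))\<^sup>2 = 4"
    proof -
      have "s = (q + p) * cnj q"
        using q by (simp add: s_def algebra_simps complex_norm_square[symmetric])
      then have "cmod s = cmod (p + q)" using q by (simp add: norm_mult add.commute)
      moreover have "(cmod (p + q))\<^sup>2 + (cmod (p - q))\<^sup>2 = 2 * (cmod p)\<^sup>2 + 2 * (cmod q)\<^sup>2"
        unfolding cmod_power2 by (simp add: power2_eq_square algebra_simps)
      ultimately show ?thesis using p q by simp
    qed
    moreover have "(cmod (p - q))\<^sup>2 > 0" using that by simp
    ultimately have "(cmod s)\<^sup>2 < 2\<^sup>2" unfolding power2_eq_square[of 2] by linarith
    then show ?thesis by (rule power2_less_imp_less) simp
  qed
  assume "p \<noteq> q"
  note lt = lt[OF this]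
  \<comment> \<open>The phase that rotates \<open>s\<close> onto the nonnegative real axis. For
    \<open>s = 0\<close> any unit works, but \<open>sgn 0 = 0\<close> is not one.\<close>
  define \<theta> where "\<theta> = (if s = 0 then 1 else cnj (sgn s))"
  have \<theta>: "cmod \<theta> = 1" "\<theta> * s = of_real (cmod s)"
  proof -
    show "cmod \<theta> = 1" by (simp add: \<theta>_def norm_sgn)
    have "cnj s * s = of_real (cmod s) * of_real (cmod s)"
      using complex_norm_square[of s] by (simp add: power2_eq_square mult.commute)
    then show "\<theta> * s = of_real (cmod s)" by (simp add: \<theta>_def sgn_eq)
  qed
  \<comment> \<open>Entries of equal modulus give equality in 2|x||y| \<le> |x|^2 + |y|^2, and the
    phase makes the cross term real: \<epsilon> = 1 gives the greatest stretch, \<epsilon> = -1 the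
    least.\<close>
  define e where "e \<epsilon> = vec 2 (\<lambda>i. of_real (1 / sqrt 2) * (if i = 0 then of_real \<epsilon> * \<theta> else 1))" for \<epsilon> :: real
  have e: "e \<epsilon> \<in> carrier_vec 2" "vec_norm2 (e \<epsilon>) = 1"
    "vec_norm2 (A *\<^sub>v e \<epsilon>) = sqrt (2 + \<epsilon> * cmod s)" if "\<epsilon>\<^sup>2 = 1" for \<epsilon>
  proof -
    show e1: "e \<epsilon> \<in> carrier_vec 2" by (simp add: e_def)
    show e2: "vec_norm2 (e \<epsilon>) = 1"
      using that \<theta>(1)
      by (simp add: vec_norm2_dim2[OF e1]) (simp add: e_def norm_mult norm_divide power_mult_distrib power_divide)
    have "e \<epsilon> $ 0 * cnj (e \<epsilon> $ 1) * s = of_real (1 / sqrt 2 * (1 / sqrt 2) * \<epsilon>) * (\<theta> * s)"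
      unfolding of_real_mult by (simp add: e_def)
    also have "\<dots> = of_real (\<epsilon> * cmod s / 2)"
      unfolding \<theta>(2) by (simp flip: of_real_mult)
    finally have "Re (e \<epsilon> $ 0 * cnj (e \<epsilon> $ 1) * s) = \<epsilon> * cmod s / 2"
      by (simp only: Re_complex_of_real)
    then show "vec_norm2 (A *\<^sub>v e \<epsilon>) = sqrt (2 + \<epsilon> * cmod s)"
      unfolding norm_A[OF e1] e2 by (simp only:) simp
  qed
  have "mat_cond A = ereal (sqrt (2 + cmod s) / sqrt (2 - cmod s))"
  proof (rule mat_cond_eqI[OF A])
    fix v :: "complex vec" assume v: "v \<in> carrier_vec 2"
    have "sqrt (2 - cmod s) * vec_norm2 v = sqrt ((2 - cmod s) * (vec_norm2 v)\<^sup>2)"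
      "sqrt (2 + cmod s) * vec_norm2 v = sqrt ((2 + cmod s) * (vec_norm2 v)\<^sup>2)"
      by (simp_all add: real_sqrt_mult vec_norm2_nonneg)
    then show "sqrt (2 - cmod s) * vec_norm2 v \<le> vec_norm2 (A *\<^sub>v v)"
      "vec_norm2 (A *\<^sub>v v) \<le> sqrt (2 + cmod s) * vec_norm2 v"
      unfolding norm_A[OF v] using re[OF v] by (auto simp: algebra_simps)
  qed (use lt e[of "- 1"] e[of 1] in auto)
  then show "(mat_cond A)\<^sup>2 = ereal ((2 + cmod s) / (2 - cmod s))"
    using lt by (simp add: power_divide)
qed

text \<open>By \<open>mat_cond_char_mat\<close> the points and characters may be listed in any
  order; with \<open>x\<close> first, the first row is constantly 1.\<close>

lemma riesz_ratio_wrt_pair: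
  assumes "b \<noteq> c" "x \<noteq> y" "b x = 1" "c x = 1"
  shows "riesz_ratio_wrt {x, y} {b, c}
    = (mat_cond (mat 2 2 (\<lambda>(i, j). if i = 0 then 1 else if j = 0 then b y else c y)))\<^sup>2"
proof -
  have bij: "bij_betw (\<lambda>i::nat. if i = 0 then u else v) {..<2} {u, v}" if "u \<noteq> v" for u v :: 'z
    using that by (auto simp: bij_betw_def inj_on_def numeral_2_eq_2 lessThan_Suc)
  have "mat 2 2 (\<lambda>(i, j). (if j = 0 then b else c) (if i = 0 then x else y))
    = mat 2 2 (\<lambda>(i, j). if i = 0 then 1 else if j = 0 then b y else c y)"
    using assms by (intro eq_matI) auto
  then show ?thesis
    unfolding riesz_ratio_wrt_def mat_cond_char_mat[OF bij[OF assms(2)] bij[OF assms(1)]] by simp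
qed

section \<open>Characters of cyclic groups and roots of unity\<close>

lemma character_integer_mod_group:
  assumes "b \<in> characters (integer_mod_group N)" "N > 1"
  shows "b 0 = 1" "b 1 ^ N = 1" "cmod (b 1) = 1"
proof -
  let ?G = "integer_mod_group N"
  interpret group ?G by simp
  have b: "b \<in> hom ?G circle_group" using assms(1) by (simp add: characters_def)
  have carrier: "carrier ?G = {0..<int N}" using assms(2) by (simp add: carrier_integer_mod_group)
  have add: "b ((x + y) mod int N) = b x * b y" if "x \<in> {0..<int N}" "y \<in> {0..<int N}" for x y
    using hom_mult[OF b, of x y] that by (simp add: carrier circle_group_def)
  have norm: "cmod (b x) = 1" if "x \<in> {0..<int N}" for x
    using hom_in_carrier[OF b, of x] that by (simp add: carrier circle_group_def)
  show "cmod (b 1) = 1" using norm[of 1] assms(2) by simp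
  have "b 0 \<noteq> 0" using norm[of 0] assms(2) by auto
  then show b0: "b 0 = 1" using add[of 0 0] assms(2) by simp
  \<comment> \<open>The element 1 generates the group; going once around, \<open>k = N\<close>
    returns to \<open>b 0 = 1\<close>.\<close>
  have "b (int k mod int N) = b 1 ^ k" for k
  proof (induction k)
    case (Suc k)
    have "b (int (Suc k) mod int N) = b ((int k mod int N + 1) mod int N)"
      by (simp add: mod_simps add.commute)
    also have "\<dots> = b (int k mod int N) * b 1" using assms(2) by (intro add) auto
    finally show ?case using Suc by simp
  qed (simp add: b0)
  from this[of N] show "b 1 ^ N = 1" by (simp add: b0)
qed

text \<open>Turns roots of unity into characters: \<open>w ^ N = 1\<close> makes the exponent matter
  only modulo \<open>N\<close>, and \<open>restrict\<close> gives the extensionality demanded by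
  \<open>characters\<close>.\<close>

lemma power_character:
  assumes w: "w ^ N = 1" and N: "N > 0"
  shows "restrict (\<lambda>x. w ^ nat x) (carrier (integer_mod_group N)) \<in> characters (integer_mod_group N)"
proof -
  have norm: "cmod w = 1" using N power_eq_1_iff[OF w] by simp
  have "w ^ nat ((x + y) mod int N) = w ^ nat x * w ^ nat y"
    if "x \<in> {0..<int N}" "y \<in> {0..<int N}" for x y
  proof -
    have mod: "w ^ (k mod N) = w ^ k" for k
    proof -
      have "w ^ k = w ^ (N * (k div N) + k mod N)" by simp
      also have "\<dots> = w ^ (k mod N)" unfolding power_add power_mult w by simp
      finally show ?thesis ..
    qed
    have "nat ((x + y) mod int N) = (nat x + nat y) mod N"
      using that by (simp add: nat_mod_distrib nat_add_distrib)
    then show ?thesis by (simp add: mod power_add)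
  qed
  then show ?thesis
    using N norm
    by (auto simp: characters_def hom_def circle_group_def carrier_integer_mod_group norm_power)
qed

section \<open>The Riesz ratio of two adjacent points\<close>

text \<open>One pair of characters gives the upper bound. The minimum runs over a finite nonempty
  set, so it inherits the strict bound that holds for every pair.\<close>

lemma riesz_ratio_odd_cyclic:
  assumes N: "odd N" "N > 1" and w: "w ^ N = 1" "w \<noteq> 1"
  shows "1 < riesz_ratio (integer_mod_group N) {0, 1}"
    and "riesz_ratio (integer_mod_group N) {0, 1} \<le> ereal ((2 + cmod (1 + w)) / (2 - cmod (1 + w)))"
proof -
  let ?G = "integer_mod_group N"
  let ?R = "{riesz_ratio_wrt {0, 1} B | B. B \<subseteq> characters ?G \<and> card B = card {0, 1 :: int}}"
  have "finite (characters ?G)"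
    using N by (intro finite_characters) (auto simp: carrier_integer_mod_group)
  then have "finite (Pow (characters ?G))" by simp
  then have fin: "finite ?R"
    by (rule finite_subset[rotated, OF finite_imageI[of _ "riesz_ratio_wrt {0, 1}"]]) auto
  have mem: "ereal ((2 + cmod (1 + w)) / (2 - cmod (1 + w))) \<in> ?R"
  proof -
    \<comment> \<open>\<open>\<chi> z\<close> takes the value \<open>z\<close> at 1. Pairing
      \<open>\<chi> w\<close> with the trivial character \<open>\<chi> 1\<close> gives
      \<open>p = w\<close>, \<open>q = 1\<close>, hence \<open>s = 1 + w\<close>.\<close>
    define \<chi> where "\<chi> z = restrict (\<lambda>x. z ^ nat x) (carrier ?G)" for z :: complex
    have \<chi>: "\<chi> w \<in> characters ?G" "\<chi> 1 \<in> characters ?G"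
      unfolding \<chi>_def using w N by (intro power_character; simp)+
    have val: "\<chi> z 1 = z" for z using N by (simp add: \<chi>_def carrier_integer_mod_group)
    then have ne: "\<chi> w \<noteq> \<chi> 1" using w(2) by metis
    have "cmod w = 1" using character_integer_mod_group(3)[OF \<chi>(1)] N by (simp add: val)
    then have "riesz_ratio_wrt {0, 1} {\<chi> w, \<chi> 1} = ereal ((2 + cmod (1 + w)) / (2 - cmod (1 + w)))"
      using riesz_ratio_wrt_pair[OF ne, of 0 1] character_integer_mod_group(1)[OF \<chi>(1) N(2)]
        character_integer_mod_group(1)[OF \<chi>(2) N(2)] mat_cond_char_2(3)[of w 1] w(2)
      unfolding val by simp
    then show ?thesis
      using \<chi> ne by (intro CollectI exI[of _ "{\<chi> w, \<chi> 1}"]) auto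
  qed
  then show "riesz_ratio ?G {0, 1} \<le> ereal ((2 + cmod (1 + w)) / (2 - cmod (1 + w)))"
    unfolding riesz_ratio_def by (rule Min_le[OF fin])
  from mem have "?R \<noteq> {}" by blast
  moreover have "1 < riesz_ratio_wrt {0, 1 :: int} B" if B: "B \<subseteq> characters ?G" "card B = 2" for B
  proof -
    obtain b c where bc: "B = {b, c}" "b \<noteq> c" using B(2) by (auto simp: card_2_iff)
    note b = character_integer_mod_group[of b, OF _ N(2)]
    note c = character_integer_mod_group[of c, OF _ N(2)]
    have mem: "b \<in> characters ?G" "c \<in> characters ?G" using B bc by auto
    note b = b[OF mem(1)] and c = c[OF mem(2)]
    have eq: "riesz_ratio_wrt {0, 1} B =
        (mat_cond (mat 2 2 (\<lambda>(i, j). if i = 0 then 1 else if j = 0 then b 1 else c 1)))\<^sup>2"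
      unfolding bc(1) using b c bc(2) by (intro riesz_ratio_wrt_pair) auto
    show ?thesis
    \<comment> \<open>Equal values at 1 give a singular matrix and the ratio \<infinity>, which
      exceeds 1.\<close>
    proof (cases "b 1 = c 1")
      case True
      then show ?thesis unfolding eq using mat_cond_char_2(1)[OF b(3) c(3)] by simp
    next
      case False
      let ?s = "1 + b 1 * cnj (c 1)"
      \<comment> \<open>With \<open>cmod ?s < 2\<close>, the ratio exceeds 1 exactly when
        \<open>?s\<close> is nonzero. Oddness of \<open>N\<close> enters here.\<close>
      have "?s \<noteq> 0"
      proof
        assume "?s = 0"
        then have "b 1 * cnj (c 1) = - 1" by (simp add: add_eq_0_iff)
        then have "(b 1 * cnj (c 1)) ^ N = - 1" using N by simp
        moreover have "(b 1 * cnj (c 1)) ^ N = 1"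
          using b(2) c(2) by (simp add: power_mult_distrib flip: complex_cnj_power)
        ultimately show False by simp
      qed
      then show ?thesis
        unfolding eq mat_cond_char_2(3)[OF b(3) c(3) False]
        using mat_cond_char_2(2)[OF b(3) c(3) False] by (simp add: field_simps)
    qed
  qed
  ultimately show "1 < riesz_ratio ?G {0, 1}"
    unfolding riesz_ratio_def using fin by (subst Min_gr_iff) auto
qed

section \<open>Convergence along odd cyclic groups\<close>

theorem theorem1p4:
  shows "\<exists>(G :: nat \<Rightarrow> int monoid) (E :: nat \<Rightarrow> int set).
    (\<forall>n. comm_group (G n) \<and> finite (carrier (G n)) \<and>
         E n \<noteq> {} \<and> E n \<subseteq> carrier (G n) \<and>
         1 < riesz_ratio (G n) (E n)) \<and>
    (\<lambda>n. riesz_ratio (G n) (E n)) \<longlonglongrightarrow> 1"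
proof -
  define N :: "nat \<Rightarrow> nat" where "N n = 2 * n + 3" for n
  define \<rho> where "\<rho> n = riesz_ratio (integer_mod_group (N n)) {0, 1}" for n
  \<comment> \<open>An \<open>N n\<close>-th root of unity nearest to -1: for odd \<open>N n\<close>
    the power is (-1) * cis \<pi> = 1.\<close>
  define w where "w n = - cis (pi / N n)" for n
  have N: "odd (N n)" "N n > 1" for n by (auto simp: N_def)
  have w: "w n ^ N n = 1" for n
    using N[of n] by (simp add: w_def power_minus_odd DeMoivre)
  have w1: "w n \<noteq> 1" for n
  proof
    assume "w n = 1"
    then have "Re (w n) = 1" by simp
    \<comment> \<open>\<open>N n\<close> is at least 3, so the angle \<pi> / \<open>N n\<close>
      stays below \<pi> / 2 and its cosine is positive.\<close>
    moreover have "Re (w n) < 0"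
    proof -
      have "- (pi / 2) < pi / N n" by (rule less_trans[of _ 0]) (auto simp: N_def)
      moreover have "pi / N n < pi / 2" by (intro divide_strict_left_mono) (auto simp: N_def)
      ultimately show ?thesis using cos_gt_zero_pi by (simp add: w_def)
    qed
    ultimately show False by simp
  qed
  have gt: "1 < \<rho> n" and le: "\<rho> n \<le> ereal ((2 + cmod (1 + w n)) / (2 - cmod (1 + w n)))" for n
    unfolding \<rho>_def using riesz_ratio_odd_cyclic[OF N w w1] by auto
  have "filterlim N at_top sequentially"
    unfolding N_def by (rule filterlim_subseq) (simp add: strict_mono_def)
  then have "(\<lambda>n. pi / N n) \<longlonglongrightarrow> 0"
    by (intro tendsto_divide_0[OF tendsto_const] filterlim_at_top_imp_at_infinity
        filterlim_compose[OF filterlim_real_sequentially])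
  then have "w \<longlonglongrightarrow> - cis 0"
    unfolding w_def by (intro tendsto_minus tendsto_cis)
  \<comment> \<open>At the limit \<open>- cis 0\<close>, which is -1, the denominator is 2 and the
    quotient is 1.\<close>
  then have "(\<lambda>n. (2 + cmod (1 + w n)) / (2 - cmod (1 + w n)))
      \<longlonglongrightarrow> (2 + cmod (1 + - cis 0)) / (2 - cmod (1 + - cis 0))"
    by (intro tendsto_intros) auto
  then have lim: "(\<lambda>n. ereal ((2 + cmod (1 + w n)) / (2 - cmod (1 + w n)))) \<longlonglongrightarrow> 1"
    by (simp add: one_ereal_def)
  have "\<rho> \<longlonglongrightarrow> 1"
  \<comment> \<open>The ratios are squeezed between 1 and the bound from the chosen pair.\<close>
  proof (rule tendsto_sandwich[OF _ _ tendsto_const lim])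
    show "\<forall>\<^sub>F n in sequentially. 1 \<le> \<rho> n"
      by (rule always_eventually) (use gt less_imp_le in blast)
    show "\<forall>\<^sub>F n in sequentially. \<rho> n \<le> ereal ((2 + cmod (1 + w n)) / (2 - cmod (1 + w n)))"
      by (rule always_eventually) (use le in blast)
  qed
  moreover have "finite (carrier (integer_mod_group (N n)))" "{0, 1} \<subseteq> carrier (integer_mod_group (N n))" for n
    by (auto simp: carrier_integer_mod_group N_def)
  ultimately show ?thesis
    using gt unfolding \<rho>_def
    by (intro exI[of _ "\<lambda>n. integer_mod_group (N n)"] exI[of _ "\<lambda>_. {0, 1}"]) simp
qed

end
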